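(* Let $n\ge1$ and let $E$ be a pluripolar set in $\mathbb{P}^n$. For $\mu,\beta>0$ put $$E_{\mu,\beta}:=\Big\{Z\in\mathbb{P}^n:\ \sigma(Z,s,E)\le\beta-\tfrac1\mu s\ \text{ for each } s>0\Big\},\qquad E_{\mu,\infty}:=\bigcup_{\beta>0}E_{\mu,\beta}.$$ Then the pluripolar hull of $E$ is $E^*=\bigcup_{\mu>0}E_{\mu,\infty}$.
   Context: Let $\omega:=dd^c\log|Z|=\frac{i}{2\pi}\partial\bar\partial\log(|Z_0|^2+\cdots+|Z_n|^2)$ be the Fubini–Study form on complex projective space $\mathbb{P}^n$, where $d^c=\frac{i}{2\pi}(\bar\partial-\partial)$. A function $\varphi:\mathbb{P}^n\to\mathbb{R}\cup\{-\infty\}$ is $\omega$-plurisubharmonic if $\varphi+\psi$ is plurisubharmonic on $U$ for each open $U\subset\mathbb{P}^n$ and each $C^\infty$ function $\psi$ on $U$ with $dd^c\psi=\omega$; the constant $-\infty$ is considered both plurisubharmonic and $\omega$-plurisubharmonic. $\mathrm{PSH}_\omega(\mathbb{P}^n)$ is the set of all such $\varphi$. A set $E\subset\mathbb{P}^n$ is pluripolar if there is $\varphi\in\mathrm{PSH}_\omega(\mathbb{P}^n)$, $\varphi\not\equiv-\infty$, with $E\subset\{\varphi=-\infty\}$. The pluripolar hull of a pluripolar set $E$ is $E^*=\bigcap\{Z\in\mathbb{P}^n:\varphi(Z)=-\infty\}$, the intersection being over all $\varphi\in\mathrm{PSH}_\omega(\mathbb{P}^n)$ that are $-\infty$ on $E$.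 For $E\subset\mathbb{P}^n$, $Z\in\mathbb{P}^n$, $s\ge0$, the relative $\omega$-plurisubharmonic extremal function is $\sigma(Z,s,E)=\sup\{\varphi(Z):\varphi\in\mathrm{PSH}_\omega(\mathbb{P}^n),\ \varphi\le -s\chi_E\}$, where $\chi_E$ is the characteristic function of $E$. *)

theory Defs
  imports "HOL-Analysis.Analysis"
begin

section \<open>Complex projective space\<close>

text \<open>
  Homogeneous coordinates on \<open>\<P>\<^sup>n\<close>, \<open>n = CARD('n)\<close>, are indexed by \<open>'n option\<close>, which has
  \<open>n + 1\<close> elements; \<open>n \<ge> 1\<close> holds because types are nonempty. A point is a complex line
  through the origin of \<open>\<complex>\<^sup>n\<^sup>+\<^sup>1\<close>.
\<close>

definition complex_line :: "complex ^ 'm \<Rightarrow> (complex ^ 'm) set"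
  where "complex_line Z = range (\<lambda>c. c *s Z)"

typedef 'n cproj = "{complex_line Z | Z :: complex ^ ('n::finite) option. Z \<noteq> 0}"
proof -
  have "axis None 1 \<noteq> (0 :: complex ^ 'n option)"
    by (simp add: axis_eq_0_iff)
  then show ?thesis by blast
qed

definition to_proj :: "complex ^ 'n option \<Rightarrow> ('n::finite) cproj"
  where "to_proj Z = Abs_cproj (complex_line Z)"

text \<open>The quotient topology.\<close>

instantiation cproj :: (finite) topological_space
begin

definition open_cproj :: "'a cproj set \<Rightarrow> bool"
  where "open_cproj U \<longleftrightarrow> open {Z. Z \<noteq> 0 \<and> to_proj Z \<in> U}"

instance
proof
  have "{Z :: complex ^ 'a option. Z \<noteq> 0 \<and> to_proj Z \<in> UNIV} = - {0}"
    by auto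
  then show "open (UNIV :: 'a cproj set)"
    unfolding open_cproj_def by (simp add: open_Compl)
next
  fix S T :: "'a cproj set"
  assume "open S" "open T"
  moreover have "{Z. Z \<noteq> 0 \<and> to_proj Z \<in> S \<inter> T} =
      {Z. Z \<noteq> 0 \<and> to_proj Z \<in> S} \<inter> {Z. Z \<noteq> 0 \<and> to_proj Z \<in> T}"
    by auto
  ultimately show "open (S \<inter> T)"
    unfolding open_cproj_def by (simp only: open_Int)
next
  fix K :: "'a cproj set set"
  assume "\<forall>S\<in>K. open S"
  moreover have "{Z. Z \<noteq> 0 \<and> to_proj Z \<in> \<Union> K} = (\<Union>S\<in>K. {Z. Z \<noteq> 0 \<and> to_proj Z \<in> S})"
    by auto
  ultimately show "open (\<Union> K)"
    unfolding open_cproj_def by (simp only: open_UN)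
qed

end

text \<open>
  The standard affine charts. The \<open>i\<close>-th homogeneous coordinate is set to 1 and the remaining
  \<open>n\<close> are the affine coordinates: slot \<open>Some j\<close> carries \<open>z $ j\<close>, except that for \<open>i = Some j\<close>
  the displaced coordinate \<open>z $ j\<close> goes into slot \<open>None\<close>.
\<close>

definition affine_lift :: "'n option \<Rightarrow> complex ^ 'n \<Rightarrow> complex ^ ('n::finite) option"
  where "affine_lift i z =
    (\<chi> k. if k = i then 1 else case k of None \<Rightarrow> z $ the i | Some j \<Rightarrow> z $ j)"

definition affine_chart :: "'n option \<Rightarrow> complex ^ 'n \<Rightarrow> ('n::finite) cproj"
  where "affine_chart i z = to_proj (affine_lift i z)"


section \<open>Smooth functions and \<open>dd\<^sup>c\<close>\<close>

text \<open>For open \<open>S\<close>.\<close>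

primrec Ck_on :: "nat \<Rightarrow> 'a::real_normed_vector set \<Rightarrow> ('a \<Rightarrow> real) \<Rightarrow> bool"
  where
    "Ck_on 0 S f \<longleftrightarrow> continuous_on S f"
  | "Ck_on (Suc k) S f \<longleftrightarrow> (\<forall>x\<in>S. f differentiable (at x)) \<and>
      (\<forall>v. Ck_on k S (\<lambda>x. frechet_derivative f (at x) v))"

definition smooth_on :: "'a::real_normed_vector set \<Rightarrow> ('a \<Rightarrow> real) \<Rightarrow> bool"
  where "smooth_on S f \<longleftrightarrow> (\<forall>k. Ck_on k S f)"

text \<open>
  Complex-valued differential forms on \<open>\<complex>\<^sup>n\<close> are functions of the point and of tangent vectors.
  The forms \<open>\<partial>u\<close> and \<open>\<partial>\<bar>u\<close> are the complex linear and antilinear parts of the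
  differential of \<open>u\<close>.
\<close>

definition del :: "(complex ^ 'n \<Rightarrow> complex) \<Rightarrow> complex ^ 'n \<Rightarrow> complex ^ ('n::finite) \<Rightarrow> complex"
  where "del u z v =
    (frechet_derivative u (at z) v - \<i> * frechet_derivative u (at z) (\<i> *s v)) / 2"

definition delbar :: "(complex ^ 'n \<Rightarrow> complex) \<Rightarrow> complex ^ 'n \<Rightarrow> complex ^ ('n::finite) \<Rightarrow> complex"
  where "delbar u z v =
    (frechet_derivative u (at z) v + \<i> * frechet_derivative u (at z) (\<i> *s v)) / 2"

definition d_c :: "(complex ^ 'n \<Rightarrow> complex) \<Rightarrow> complex ^ 'n \<Rightarrow> complex ^ ('n::finite) \<Rightarrow> complex"
  where "d_c u z v = \<i> / (2 * of_real pi) * (delbar u z v - del u z v)"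

text \<open>Exterior derivative of a 1-form: \<open>d\<alpha>(v, w) = v(\<alpha>(w)) - w(\<alpha>(v))\<close> for constant fields \<open>v, w\<close>.\<close>

definition ext_d :: "(complex ^ 'n \<Rightarrow> complex ^ 'n \<Rightarrow> complex) \<Rightarrow>
    complex ^ 'n \<Rightarrow> complex ^ 'n \<Rightarrow> complex ^ ('n::finite) \<Rightarrow> complex"
  where "ext_d \<alpha> z v w =
    frechet_derivative (\<lambda>y. \<alpha> y w) (at z) v - frechet_derivative (\<lambda>y. \<alpha> y v) (at z) w"

definition dd_c :: "(complex ^ 'n \<Rightarrow> real) \<Rightarrow>
    complex ^ 'n \<Rightarrow> complex ^ 'n \<Rightarrow> complex ^ ('n::finite) \<Rightarrow> complex"
  where "dd_c u = ext_d (d_c (\<lambda>z. complex_of_real (u z)))"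

text \<open>
  The Fubini--Study form \<open>dd\<^sup>c log |Z|\<close> expressed in the \<open>i\<close>-th chart, i.e. pulled back by the
  section \<open>affine_lift i\<close> of the projection to \<open>\<P>\<^sup>n\<close>.
\<close>

definition fubini_study :: "'n option \<Rightarrow>
    complex ^ 'n \<Rightarrow> complex ^ 'n \<Rightarrow> complex ^ ('n::finite) \<Rightarrow> complex"
  where "fubini_study i = dd_c (\<lambda>z. ln (norm (affine_lift i z)))"

definition smooth_on_proj :: "('n::finite) cproj set \<Rightarrow> ('n cproj \<Rightarrow> real) \<Rightarrow> bool"
  where "smooth_on_proj U \<psi> \<longleftrightarrow> (\<forall>i. smooth_on (affine_chart i -` U) (\<psi> \<circ> affine_chart i))"

definition omega_potential_on :: "('n::finite) cproj set \<Rightarrow> ('n cproj \<Rightarrow> real) \<Rightarrow> bool"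
  where "omega_potential_on U \<psi> \<longleftrightarrow> smooth_on_proj U \<psi> \<and>
    (\<forall>i. \<forall>z \<in> affine_chart i -` U. dd_c (\<psi> \<circ> affine_chart i) z = fubini_study i z)"


section \<open>Plurisubharmonic functions\<close>

definition usc_on :: "'a::topological_space set \<Rightarrow> ('a \<Rightarrow> ereal) \<Rightarrow> bool"
  where "usc_on S u \<longleftrightarrow> (\<forall>c. openin (top_of_set S) {x \<in> S. u x < c})"

text \<open>
  Lebesgue integral of an extended real function as the difference of the integrals of its
  positive and negative parts; \<^const>\<open>e2ennreal\<close> maps negative values to 0. It is used only for
  functions that are bounded above on a space of finite measure, so the first integral is finite.
\<close>

definition ereal_integral :: "'a measure \<Rightarrow> ('a \<Rightarrow> ereal) \<Rightarrow> ereal"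
  where "ereal_integral M f =
    enn2ereal (\<integral>\<^sup>+ x. e2ennreal (f x) \<partial>M) - enn2ereal (\<integral>\<^sup>+ x. e2ennreal (- f x) \<partial>M)"

definition circle_mean :: "(complex \<Rightarrow> ereal) \<Rightarrow> complex \<Rightarrow> real \<Rightarrow> ereal"
  where "circle_mean u a r = ereal (1 / (2 * pi)) *
    ereal_integral (restrict_space lborel {0..2 * pi}) (\<lambda>t. u (a + of_real r * cis t))"

text \<open>
  For open sets. The value \<open>- \<infinity>\<close> is allowed everywhere, so the constant \<open>- \<infinity>\<close> counts as
  subharmonic and plurisubharmonic.
\<close>

definition subharmonic_on :: "complex set \<Rightarrow> (complex \<Rightarrow> ereal) \<Rightarrow> bool"
  where "subharmonic_on G u \<longleftrightarrow> usc_on G u \<and> (\<forall>z\<in>G. u z \<noteq> \<infinity>) \<and>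
    (\<forall>a r. 0 < r \<and> cball a r \<subseteq> G \<longrightarrow> u a \<le> circle_mean u a r)"

definition psh_on :: "(complex ^ 'n) set \<Rightarrow> (complex ^ ('n::finite) \<Rightarrow> ereal) \<Rightarrow> bool"
  where "psh_on D u \<longleftrightarrow> usc_on D u \<and> (\<forall>z\<in>D. u z \<noteq> \<infinity>) \<and>
    (\<forall>a\<in>D. \<forall>b. subharmonic_on {\<zeta>. a + \<zeta> *s b \<in> D} (\<lambda>\<zeta>. u (a + \<zeta> *s b)))"

definition psh_on_proj :: "('n::finite) cproj set \<Rightarrow> ('n cproj \<Rightarrow> ereal) \<Rightarrow> bool"
  where "psh_on_proj U u \<longleftrightarrow> (\<forall>i. psh_on (affine_chart i -` U) (u \<circ> affine_chart i))"

definition PSH_omega :: "(('n::finite) cproj \<Rightarrow> ereal) set"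
  where "PSH_omega = {\<phi>. (\<forall>Z. \<phi> Z \<noteq> \<infinity>) \<and>
    (\<forall>U \<psi>. open U \<and> omega_potential_on U \<psi> \<longrightarrow> psh_on_proj U (\<lambda>Z. \<phi> Z + ereal (\<psi> Z)))}"


section \<open>Pluripolar sets and the relative extremal function\<close>

definition pluripolar :: "('n::finite) cproj set \<Rightarrow> bool"
  where "pluripolar E \<longleftrightarrow>
    (\<exists>\<phi>\<in>PSH_omega. \<phi> \<noteq> (\<lambda>_. - \<infinity>) \<and> E \<subseteq> {Z. \<phi> Z = - \<infinity>})"

definition pluripolar_hull :: "('n::finite) cproj set \<Rightarrow> 'n cproj set"
  where "pluripolar_hull E =
    (\<Inter>\<phi> \<in> {\<phi> \<in> PSH_omega. \<forall>Z\<in>E. \<phi> Z = - \<infinity>}. {Z. \<phi> Z = - \<infinity>})"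

definition extremal :: "('n::finite) cproj \<Rightarrow> real \<Rightarrow> 'n cproj set \<Rightarrow> ereal"
  where "extremal Z s E =
    (SUP \<phi> \<in> {\<phi> \<in> PSH_omega. \<forall>W. \<phi> W \<le> ereal (- s * indicator E W)}. \<phi> Z)"

definition decay_set :: "('n::finite) cproj set \<Rightarrow> real \<Rightarrow> real \<Rightarrow> 'n cproj set"
  where "decay_set E \<mu> \<beta> = {Z. \<forall>s>0. extremal Z s E \<le> ereal (\<beta> - 1 / \<mu> * s)}"

definition decay_set_infinity :: "('n::finite) cproj set \<Rightarrow> real \<Rightarrow> 'n cproj set"
  where "decay_set_infinity E \<mu> = (\<Union>\<beta>\<in>{0<..}. decay_set E \<mu> \<beta>)"

end

theory Submission
  imports Defs
begin

text \<open>
  Write \<open>\<sigma>(s)\<close> for the extremal function of \<open>E\<close> at a fixed point \<open>Z\<close>. A convex combination of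
  competitors for \<open>s\<close> and \<open>s'\<close> is a competitor for the same convex combination of \<open>s\<close> and \<open>s'\<close>,
  so \<open>\<sigma>\<close> is concave; it is also nonincreasing. Such a function on the half-line is either
  constant or eventually below a line of negative slope. Membership in some decay set is
  the second alternative (or \<open>\<sigma> = - \<infinity>\<close>), and the theorem says that this is the case exactly on
  the hull.

  If \<open>\<sigma>\<close> is constant and finite, choose competitors \<open>\<phi> j\<close> for \<open>s = 2 ^ (j + 1)\<close> whose values
  at \<open>Z\<close> stay above a fixed bound. The average of the \<open>\<phi> j\<close> with weights
  \<open>2 ^ -(j + 1)\<close> is \<open>\<omega>\<close>-plurisubharmonic, equals \<open>- \<infinity>\<close> on \<open>E\<close> because each term there is at
  most \<open>-1\<close>, and is finite at \<open>Z\<close>. Hence \<open>Z\<close> is not in the hull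
  (\<open>not_in_hull_if_extremal_bounded_below\<close>). If \<open>\<sigma>\<close> is not constant, concavity gives the
  decay (\<open>extremal_linear_decay\<close>).

  Conversely, let \<open>Z\<close> be in a decay set and \<open>\<phi>\<close> be \<open>\<omega>\<close>-plurisubharmonic with value \<open>- \<infinity>\<close> on
  \<open>E\<close>. Up to a constant \<open>\<phi> \<le> 0\<close>, so \<open>\<phi>\<close> is a competitor for every \<open>s\<close> and linear decay forces
  \<open>\<phi> Z = - \<infinity>\<close> (\<open>decay_set_subset_hull\<close>).

  Two facts about \<open>\<omega>\<close>-plurisubharmonic functions carry these arguments. The first is that the
  class of nonpositive ones is closed under countable convex combinations
  (\<open>mixture_in_PSH_omega\<close>): subtracted from a fixed local potential, the sum is treated as a
  nonnegative series, with Fatou's lemma for semicontinuity and monotone convergence for the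
  mean values. Both convex combinations above are instances. The second is boundedness from above
  (\<open>PSH_omega_bounded_above\<close>). By compactness it follows from semicontinuity, and
  semicontinuity of \<open>\<phi>\<close> itself can only be extracted from the definition by exhibiting
  potentials of \<open>\<omega>\<close> near every point; these are \<open>ln (norm Z / cmod (Z $ i))\<close>.
\<close>

section \<open>Semicontinuity of series\<close>

text \<open>
  The sequential form makes Fatou's lemma applicable to sums of semicontinuous functions.
\<close>

lemma usc_on_iff_limsup:
  fixes u :: "'a::metric_space \<Rightarrow> ereal"
  shows "usc_on S u \<longleftrightarrow>
    (\<forall>x\<in>S. \<forall>X. (\<forall>n. X n \<in> S) \<longrightarrow> X \<longlonglongrightarrow> x \<longrightarrow> limsup (\<lambda>n. u (X n)) \<le> u x)"
proof
  assume usc: "usc_on S u"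
  show "\<forall>x\<in>S. \<forall>X. (\<forall>n. X n \<in> S) \<longrightarrow> X \<longlonglongrightarrow> x \<longrightarrow> limsup (\<lambda>n. u (X n)) \<le> u x"
  proof (intro ballI allI impI)
    fix x X assume x: "x \<in> S" and X: "\<forall>n. X n \<in> S" "X \<longlonglongrightarrow> x"
    show "limsup (\<lambda>n. u (X n)) \<le> u x"
    proof (rule dense_ge)
      fix c assume c: "u x < c"
      obtain T where T: "open T" "{x \<in> S. u x < c} = S \<inter> T"
        using usc unfolding usc_on_def openin_open by blast
      then have "x \<in> T" using x c by blast
      then have "\<forall>\<^sub>F n in sequentially. X n \<in> T"
        using X(2) T(1) by (simp add: topological_tendstoD)
      then have "\<forall>\<^sub>F n in sequentially. u (X n) \<le> c"
        by (rule eventually_mono) (use T(2) X(1) in force)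
      then show "limsup (\<lambda>n. u (X n)) \<le> c" by (rule Limsup_bounded)
    qed
  qed
next
  assume lim: "\<forall>x\<in>S. \<forall>X. (\<forall>n. X n \<in> S) \<longrightarrow> X \<longlonglongrightarrow> x \<longrightarrow> limsup (\<lambda>n. u (X n)) \<le> u x"
  show "usc_on S u"
    unfolding usc_on_def
  proof
    fix c
    have "closedin (top_of_set S) {x \<in> S. c \<le> u x}"
      unfolding closedin_limpt islimpt_sequential
    proof (intro conjI allI impI)
      fix x assume A: "(\<exists>f. (\<forall>n. f n \<in> {x \<in> S. c \<le> u x} - {x}) \<and> f \<longlonglongrightarrow> x) \<and> x \<in> S"
      then obtain f where f: "\<And>n. f n \<in> S" "\<And>n. c \<le> u (f n)" "f \<longlonglongrightarrow> x" by blast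
      have "c \<le> limsup (\<lambda>n. u (f n))"
        using f(2) by (intro le_Limsup) auto
      also have "\<dots> \<le> u x" using lim f A by blast
      finally show "x \<in> {x \<in> S. c \<le> u x}" using A by blast
    qed auto
    moreover have "S - {x \<in> S. c \<le> u x} = {x \<in> S. u x < c}" by auto
    ultimately show "openin (top_of_set S) {x \<in> S. u x < c}"
      by (metis openin_diff openin_subtopology_self)
  qed
qed

lemma usc_on_compose:
  assumes "usc_on S u" "continuous_on T g" "g ` T \<subseteq> S"
  shows "usc_on T (\<lambda>x. u (g x))"
  unfolding usc_on_def
proof
  fix c
  have "openin (top_of_set T) (T \<inter> g -` {x \<in> S. u x < c})"
    using assms by (intro continuous_openin_preimage[of T g S]) (auto simp: usc_on_def)
  moreover have "T \<inter> g -` {x \<in> S. u x < c} = {x \<in> T. u (g x) < c}"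
    using assms(3) by auto
  ultimately show "openin (top_of_set T) {x \<in> T. u (g x) < c}" by simp
qed

text \<open>
  A function \<open>\<phi> + \<psi>\<close> with \<open>\<phi> \<le> 0\<close> is written here as \<open>\<psi> - f\<close> with \<open>f\<close> valued in \<^typ>\<open>ennreal\<close>, where
  infinite sums need no convergence hypotheses. Since \<open>\<psi>\<close> is continuous, upper
  semicontinuity of \<open>\<psi> - f\<close> is lower semicontinuity of \<open>f\<close>.
\<close>

lemma limsup_minus_ennreal_iff:
  fixes p :: "nat \<Rightarrow> real" and f :: "nat \<Rightarrow> ennreal"
  assumes "p \<longlonglongrightarrow> q"
  shows "limsup (\<lambda>n. ereal (p n) - enn2ereal (f n)) \<le> ereal q - enn2ereal l \<longleftrightarrow> l \<le> liminf f"
proof -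
  have "limsup (\<lambda>n. ereal (p n) - enn2ereal (f n)) = limsup (\<lambda>n. ereal (p n) + - enn2ereal (f n))"
    by (simp add: minus_ereal_def)
  also have "\<dots> = ereal q + limsup (\<lambda>n. - enn2ereal (f n))"
    by (rule ereal_limsup_lim_add) (use assms in auto)
  also have "\<dots> = ereal q - liminf (\<lambda>n. enn2ereal (f n))"
    by (simp add: ereal_Limsup_uminus minus_ereal_def)
  also have "liminf (\<lambda>n. enn2ereal (f n)) = enn2ereal (liminf f)"
    by (rule Liminf_compose_continuous_mono)
       (auto simp: mono_def continuous_on_enn2ereal less_eq_ennreal.rep_eq)
  finally have *: "limsup (\<lambda>n. ereal (p n) - enn2ereal (f n)) = ereal q - enn2ereal (liminf f)" .
  show ?thesis unfolding *
    by (simp add: minus_ereal_def ereal_add_le_add_iff less_eq_ennreal.rep_eq)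
qed

lemma minus_enn2ereal_neq_PInfty: "- enn2ereal x \<noteq> \<infinity>" "ereal a - enn2ereal x \<noteq> \<infinity>"
  using enn2ereal_nonneg[of x] by (cases "enn2ereal x"; simp)+

text \<open>
  A series is an integral over the counting measure, so Fatou's lemma bounds the sum of the
  lower limits by the lower limit of the sums.
\<close>

lemma usc_on_minus_suminf:
  fixes \<psi> :: "'a::metric_space \<Rightarrow> real" and f :: "nat \<Rightarrow> 'a \<Rightarrow> ennreal"
  assumes \<psi>: "continuous_on S \<psi>"
    and f: "\<And>j. usc_on S (\<lambda>x. ereal (\<psi> x) - enn2ereal (f j x))"
  shows "usc_on S (\<lambda>x. ereal (\<psi> x) - enn2ereal (\<Sum>j. ennreal (w j) * f j x))"
  unfolding usc_on_iff_limsup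
proof (intro ballI allI impI)
  fix x X assume x: "x \<in> S" and X: "\<forall>n. X n \<in> S" "X \<longlonglongrightarrow> x"
  have lim: "(\<lambda>n. \<psi> (X n)) \<longlonglongrightarrow> \<psi> x"
    using \<psi> x X by (simp add: continuous_on_sequentially o_def)
  have le: "f j x \<le> liminf (\<lambda>n. f j (X n))" for j
    using f[of j] x X unfolding usc_on_iff_limsup
    by (simp add: limsup_minus_ennreal_iff[OF lim, symmetric])
  have "(\<Sum>j. ennreal (w j) * f j x) \<le> (\<Sum>j. liminf (\<lambda>n. ennreal (w j) * f j (X n)))"
  proof (intro suminf_le)
    fix j
    have "ennreal (w j) * f j x \<le> ennreal (w j) * liminf (\<lambda>n. f j (X n))"
      by (intro mult_left_mono le) simp
    also have "\<dots> = liminf (\<lambda>n. ennreal (w j) * f j (X n))"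
      by (rule Liminf_compose_continuous_mono[symmetric])
         (auto intro!: ennreal_continuous_on_cmult continuous_on_id mult_left_mono simp: mono_def)
    finally show "ennreal (w j) * f j x \<le> liminf (\<lambda>n. ennreal (w j) * f j (X n))" .
  qed auto
  also have "\<dots> = (\<integral>\<^sup>+ j. liminf (\<lambda>n. ennreal (w j) * f j (X n)) \<partial>count_space UNIV)"
    by (simp add: nn_integral_count_space_nat)
  also have "\<dots> \<le> liminf (\<lambda>n. \<integral>\<^sup>+ j. ennreal (w j) * f j (X n) \<partial>count_space UNIV)"
    by (rule nn_integral_liminf) simp
  also have "\<dots> = liminf (\<lambda>n. \<Sum>j. ennreal (w j) * f j (X n))"
    by (simp add: nn_integral_count_space_nat)
  finally show "limsup (\<lambda>n. ereal (\<psi> (X n)) - enn2ereal (\<Sum>j. ennreal (w j) * f j (X n)))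
      \<le> ereal (\<psi> x) - enn2ereal (\<Sum>j. ennreal (w j) * f j x)"
    by (simp add: limsup_minus_ennreal_iff[OF lim])
qed


section \<open>Mean values of series\<close>

text \<open>
  The positive and negative parts of \<open>p - g\<close> are not those of \<open>p\<close> and \<open>g\<close>; the two
  decompositions are compared through an identity between sums of nonnegative functions, which
  survives integration even where \<open>g\<close> is infinite.
\<close>

lemma ereal_integral_minus:
  fixes p :: "'a \<Rightarrow> real" and g :: "'a \<Rightarrow> ennreal"
  assumes p: "integrable M p" and g[measurable]: "g \<in> borel_measurable M"
  shows "ereal_integral M (\<lambda>x. ereal (p x) - enn2ereal (g x)) =
    ereal (integral\<^sup>L M p) - enn2ereal (\<integral>\<^sup>+ x. g x \<partial>M)"
proof -
  define A where "A = (\<integral>\<^sup>+ x. e2ennreal (ereal (p x) - enn2ereal (g x)) \<partial>M)"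
  define B where "B = (\<integral>\<^sup>+ x. e2ennreal (- (ereal (p x) - enn2ereal (g x))) \<partial>M)"
  define P where "P = (\<integral>\<^sup>+ x. ennreal (p x) \<partial>M)"
  define N where "N = (\<integral>\<^sup>+ x. ennreal (- p x) \<partial>M)"
  define G where "G = (\<integral>\<^sup>+ x. g x \<partial>M)"
  have [measurable]: "p \<in> borel_measurable M" using p by simp
  \<comment> \<open>\<open>f\<^sup>+ + (p\<^sup>- + g) = f\<^sup>- + p\<^sup>+\<close> for \<open>f = p - g\<close>.\<close>
  have pw: "e2ennreal (ereal a - enn2ereal b) + (ennreal (- a) + b) =
      e2ennreal (- (ereal a - enn2ereal b)) + ennreal a" for a b
  proof (cases b)
    case (real r)
    show ?thesis
      using real by (cases "a \<ge> 0"; cases "a \<ge> r")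
        (auto simp: e2ennreal_ereal enn2ereal_ennreal ennreal_neg ennreal_plus[symmetric] simp del: ennreal_plus)
  qed (simp add: e2ennreal_neg)
  have "A + (N + G) = B + P"
    unfolding A_def B_def P_def N_def G_def
    by (simp add: nn_integral_add[symmetric] pw)
  moreover have "P < \<infinity>" "N < \<infinity>"
    using p unfolding P_def N_def by (auto simp: real_integrable_def less_top)
  moreover have "A \<le> P"
  proof -
    have "e2ennreal (ereal a - enn2ereal b) \<le> ennreal a" for a b
    proof -
      have "ereal a - enn2ereal b \<le> ereal a"
        using enn2ereal_nonneg[of b] by (cases "enn2ereal b") auto
      then have "e2ennreal (ereal a - enn2ereal b) \<le> e2ennreal (ereal a)" by (rule e2ennreal_mono)
      then show ?thesis by (simp add: e2ennreal_ereal)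
    qed
    then show ?thesis unfolding A_def P_def by (intro nn_integral_mono)
  qed
  moreover have "integral\<^sup>L M p = enn2real P - enn2real N"
    using p unfolding P_def N_def by (rule real_lebesgue_integral_def)
  ultimately have "enn2ereal A - enn2ereal B = ereal (integral\<^sup>L M p) - enn2ereal G"
    by (cases A; cases B; cases P; cases N; cases G)
       (auto simp: enn2ereal_ennreal top_unique ennreal_plus[symmetric] simp del: ennreal_plus)
  then show ?thesis
    unfolding ereal_integral_def A_def B_def G_def .
qed

text \<open>
  The inequality \<open>\<psi> a - f a \<le> mean (\<psi> - f)\<close>, cleared of subtraction. The discrepancy
  between \<open>\<psi> a\<close> and the mean of \<open>\<psi>\<close> can have either sign; \<open>ennreal\<close> truncates negative reals, so
  its positive part appears on the left and its negative part on the right. In this form both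
  sides are affine in \<open>f\<close> with fixed constant terms, hence the inequality passes to weighted
  averages of functions \<open>f\<close>.
\<close>

lemma submean_iff:
  fixes f :: "complex \<Rightarrow> ennreal"
  assumes \<psi>: "integrable (restrict_space lborel {0..2 * pi}) (\<lambda>t. \<psi> (a + of_real r * cis t))"
    and f: "(\<lambda>t. f (a + of_real r * cis t)) \<in> borel_measurable (restrict_space lborel {0..2 * pi})"
  shows "ereal (\<psi> a) - enn2ereal (f a) \<le> circle_mean (\<lambda>z. ereal (\<psi> z) - enn2ereal (f z)) a r \<longleftrightarrow>
    (\<integral>\<^sup>+ t. f (a + of_real r * cis t) \<partial>restrict_space lborel {0..2 * pi}) +
        ennreal (2 * pi * \<psi> a - integral\<^sup>L (restrict_space lborel {0..2 * pi}) (\<lambda>t. \<psi> (a + of_real r * cis t)))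
      \<le> ennreal (2 * pi) * f a + ennreal (integral\<^sup>L (restrict_space lborel {0..2 * pi}) (\<lambda>t. \<psi> (a + of_real r * cis t)) - 2 * pi * \<psi> a)"
proof -
  have "ereal q - enn2ereal l \<le> ereal (1 / (2 * pi)) * (ereal I - enn2ereal G) \<longleftrightarrow>
      G + ennreal (2 * pi * q - I) \<le> ennreal (2 * pi) * l + ennreal (I - 2 * pi * q)" for q I l G
  proof (cases l; cases G)
    fix l' G' assume [simp]: "l = ennreal l'" "G = ennreal G'" and nn: "0 \<le> l'" "0 \<le> G'"
    have "ereal q - enn2ereal l \<le> ereal (1 / (2 * pi)) * (ereal I - enn2ereal G) \<longleftrightarrow>
        q - l' \<le> (I - G') / (2 * pi)"
      using nn by (simp add: enn2ereal_ennreal)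
    also have "\<dots> \<longleftrightarrow> G' + (2 * pi * q - I) \<le> 2 * pi * l'"
      by (simp add: field_simps)
    also have "\<dots> \<longleftrightarrow> G + ennreal (2 * pi * q - I) \<le> ennreal (2 * pi) * l + ennreal (I - 2 * pi * q)"
      using nn by (cases "2 * pi * q - I \<ge> 0")
        (auto simp: ennreal_neg ennreal_mult[symmetric] ennreal_plus[symmetric] simp del: ennreal_plus)
    finally show ?thesis .
  qed (simp_all add: ennreal_mult_top ennreal_mult_eq_top_iff top_unique)
  then show ?thesis
    unfolding circle_mean_def ereal_integral_minus[OF \<psi> f] .
qed

lemma usc_on_borel_measurable:
  assumes "usc_on S u"
  shows "u \<in> borel_measurable (restrict_space borel S)"
proof (rule borel_measurableI_less)
  fix y
  obtain T where "open T" "{x \<in> S. u x < y} = S \<inter> T"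
    using assms unfolding usc_on_def openin_open by blast
  then show "{x \<in> space (restrict_space borel S). u x < y} \<in> sets (restrict_space borel S)"
    by (auto simp: space_restrict_space sets_restrict_space)
qed

text \<open>
  Averaging the subtraction-free submean inequalities uses that the weights sum to 1: only then
  does averaging reproduce the constant terms, which come from \<open>\<psi>\<close>.
\<close>

lemma subharmonic_on_minus_suminf:
  fixes \<psi> :: "complex \<Rightarrow> real" and f :: "nat \<Rightarrow> complex \<Rightarrow> ennreal"
  assumes \<psi>: "continuous_on G \<psi>"
    and f: "\<And>j. subharmonic_on G (\<lambda>z. ereal (\<psi> z) - enn2ereal (f j z))"
    and w: "(\<Sum>j. ennreal (w j)) = 1"
  shows "subharmonic_on G (\<lambda>z. ereal (\<psi> z) - enn2ereal (\<Sum>j. ennreal (w j) * f j z))"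
  unfolding subharmonic_on_def
proof (intro conjI ballI allI impI)
  show "usc_on G (\<lambda>z. ereal (\<psi> z) - enn2ereal (\<Sum>j. ennreal (w j) * f j z))"
    using f by (intro usc_on_minus_suminf \<psi>) (simp add: subharmonic_on_def)
next
  fix z
  show "ereal (\<psi> z) - enn2ereal (\<Sum>j. ennreal (w j) * f j z) \<noteq> \<infinity>"
    by (rule minus_enn2ereal_neq_PInfty)
next
  fix a r assume r: "0 < r \<and> cball a r \<subseteq> G"
  define \<gamma> where "\<gamma> t = a + of_real r * cis t" for t
  let ?M = "restrict_space lborel {0..2 * pi}"
  have \<gamma>: "continuous_on {0..2 * pi} \<gamma>" "\<gamma> ` {0..2 * pi} \<subseteq> G"
    using r unfolding \<gamma>_def
    by (auto intro!: continuous_intros simp: subset_iff dist_norm norm_mult)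
  have p: "continuous_on {0..2 * pi} (\<lambda>t. \<psi> (\<gamma> t))"
    using continuous_on_compose2[OF \<psi> \<gamma>] .
  then have int: "integrable ?M (\<lambda>t. \<psi> (\<gamma> t))"
    using borel_integrable_compact[OF compact_Icc p] by (simp add: integrable_restrict_space)
  have [measurable]: "(\<lambda>t. f j (\<gamma> t)) \<in> borel_measurable ?M" for j
  proof -
    have "usc_on {0..2 * pi} (\<lambda>t. ereal (\<psi> (\<gamma> t)) - enn2ereal (f j (\<gamma> t)))"
      using f[of j] usc_on_compose[OF _ \<gamma>] unfolding subharmonic_on_def by blast
    then have [measurable]: "(\<lambda>t. ereal (\<psi> (\<gamma> t)) - enn2ereal (f j (\<gamma> t))) \<in> borel_measurable ?M"
      by (subst measurable_cong_sets[where M' = "restrict_space borel {0..2 * pi}"])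
         (auto simp: sets_restrict_space intro: usc_on_borel_measurable)
    have [measurable]: "(\<lambda>t. \<psi> (\<gamma> t)) \<in> borel_measurable ?M" using int by simp
    have "(\<lambda>t. e2ennreal (ereal (\<psi> (\<gamma> t)) - (ereal (\<psi> (\<gamma> t)) - enn2ereal (f j (\<gamma> t))))) \<in> borel_measurable ?M"
      by measurable
    moreover have "ereal x - (ereal x - enn2ereal y) = enn2ereal y" for x y
      by (cases "enn2ereal y") auto
    ultimately show ?thesis by simp
  qed
  let ?p = "integral\<^sup>L ?M (\<lambda>t. \<psi> (\<gamma> t))"
  define K where "K = ennreal (2 * pi * \<psi> a - ?p)"
  define K' where "K' = ennreal (?p - 2 * pi * \<psi> a)"
  have mean: "(\<integral>\<^sup>+ t. f j (\<gamma> t) \<partial>?M) + K \<le> ennreal (2 * pi) * f j a + K'" for j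
    using f[of j] r submean_iff[of \<psi> a r "f j"] int unfolding subharmonic_on_def K_def K'_def
    by (simp add: \<gamma>_def[symmetric])
  have "(\<integral>\<^sup>+ t. (\<Sum>j. ennreal (w j) * f j (\<gamma> t)) \<partial>?M) + K =
      (\<Sum>j. ennreal (w j) * (\<integral>\<^sup>+ t. f j (\<gamma> t) \<partial>?M)) + (\<Sum>j. ennreal (w j) * K)"
    by (simp add: nn_integral_suminf nn_integral_cmult ennreal_suminf_multc w)
  also have "\<dots> = (\<Sum>j. ennreal (w j) * ((\<integral>\<^sup>+ t. f j (\<gamma> t) \<partial>?M) + K))"
    by (simp add: suminf_add[symmetric] distrib_left)
  also have "\<dots> \<le> (\<Sum>j. ennreal (w j) * (ennreal (2 * pi) * f j a + K'))"
    by (intro suminf_le mult_left_mono mean) auto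
  also have "\<dots> = (\<Sum>j. ennreal (2 * pi) * (ennreal (w j) * f j a)) + (\<Sum>j. ennreal (w j) * K')"
    by (simp add: suminf_add[symmetric] distrib_left mult_ac)
  also have "\<dots> = ennreal (2 * pi) * (\<Sum>j. ennreal (w j) * f j a) + K'"
    by (simp add: ennreal_suminf_multc w)
  finally show "ereal (\<psi> a) - enn2ereal (\<Sum>j. ennreal (w j) * f j a)
      \<le> circle_mean (\<lambda>z. ereal (\<psi> z) - enn2ereal (\<Sum>j. ennreal (w j) * f j z)) a r"
    using int by (subst submean_iff) (simp_all add: \<gamma>_def[symmetric] K_def K'_def)
qed

lemma psh_on_minus_suminf:
  fixes \<psi> :: "complex ^ 'n \<Rightarrow> real" and f :: "nat \<Rightarrow> complex ^ 'n \<Rightarrow> ennreal"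
  assumes \<psi>: "continuous_on D \<psi>"
    and f: "\<And>j. psh_on D (\<lambda>z. ereal (\<psi> z) - enn2ereal (f j z))"
    and w: "(\<Sum>j. ennreal (w j)) = 1"
  shows "psh_on D (\<lambda>z. ereal (\<psi> z) - enn2ereal (\<Sum>j. ennreal (w j) * f j z))"
  unfolding psh_on_def
proof (intro conjI ballI allI)
  show "usc_on D (\<lambda>z. ereal (\<psi> z) - enn2ereal (\<Sum>j. ennreal (w j) * f j z))"
    using f by (intro usc_on_minus_suminf \<psi>) (simp add: psh_on_def)
next
  fix z
  show "ereal (\<psi> z) - enn2ereal (\<Sum>j. ennreal (w j) * f j z) \<noteq> \<infinity>"
    by (rule minus_enn2ereal_neq_PInfty)
next
  fix a b assume a: "a \<in> D"
  have "continuous_on UNIV (\<lambda>\<zeta>. a + \<zeta> *s b)"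
    unfolding vector_scalar_mult_def by (intro continuous_intros continuous_on_vec_lambda)
  then have "continuous_on {\<zeta>. a + \<zeta> *s b \<in> D} (\<lambda>\<zeta>. \<psi> (a + \<zeta> *s b))"
    by (intro continuous_on_compose2[OF \<psi>]) (auto intro: continuous_on_subset)
  then show "subharmonic_on {\<zeta>. a + \<zeta> *s b \<in> D}
      (\<lambda>\<zeta>. ereal (\<psi> (a + \<zeta> *s b)) - enn2ereal (\<Sum>j. ennreal (w j) * f j (a + \<zeta> *s b)))"
    using f a w by (intro subharmonic_on_minus_suminf) (auto simp: psh_on_def)
qed

section \<open>Countable convex combinations of \<open>\<omega>\<close>-plurisubharmonic functions\<close>

text \<open>
  The weighted average of nonpositive functions \<open>\<phi> j\<close>, computed as minus a series of
  nonnegative terms so that it makes sense with value \<open>- \<infinity>\<close>.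
\<close>

definition mixture :: "(nat \<Rightarrow> real) \<Rightarrow> (nat \<Rightarrow> 'a \<Rightarrow> ereal) \<Rightarrow> 'a \<Rightarrow> ereal"
  where "mixture w \<phi> x = - enn2ereal (\<Sum>j. ennreal (w j) * e2ennreal (- \<phi> j x))"

text \<open>
  All \<open>\<phi> j\<close> are tested against the same potential \<open>\<psi>\<close>, which reduces the claim to the local one
  in each chart.
\<close>

lemma mixture_in_PSH_omega:
  fixes \<phi> :: "nat \<Rightarrow> ('n::finite) cproj \<Rightarrow> ereal"
  assumes \<phi>: "\<And>j. \<phi> j \<in> PSH_omega" and neg: "\<And>j Z. \<phi> j Z \<le> 0" and w: "(\<Sum>j. ennreal (w j)) = 1"
  shows "mixture w \<phi> \<in> PSH_omega"
  unfolding PSH_omega_def mem_Collect_eq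
proof (intro conjI allI impI)
  fix Z show "mixture w \<phi> Z \<noteq> \<infinity>" unfolding mixture_def by (rule minus_enn2ereal_neq_PInfty)
next
  fix U and \<psi> :: "'n cproj \<Rightarrow> real" assume U: "open U \<and> omega_potential_on U \<psi>"
  show "psh_on_proj U (\<lambda>Z. mixture w \<phi> Z + ereal (\<psi> Z))"
    unfolding psh_on_proj_def
  proof
    fix i
    let ?D = "affine_chart i -` U"
    have c: "continuous_on ?D (\<lambda>z. \<psi> (affine_chart i z))"
      using U Ck_on.simps(1) unfolding omega_potential_on_def smooth_on_proj_def smooth_on_def o_def
      by blast
    have "psh_on ?D (\<lambda>z. ereal (\<psi> (affine_chart i z)) - enn2ereal (e2ennreal (- \<phi> j (affine_chart i z))))"
      for j
    proof -
      have "psh_on ?D (\<lambda>z. \<phi> j (affine_chart i z) + ereal (\<psi> (affine_chart i z)))"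
        using \<phi>[of j] U unfolding PSH_omega_def psh_on_proj_def o_def by blast
      moreover have "ereal (\<psi> Z) - enn2ereal (e2ennreal (- \<phi> j Z)) = \<phi> j Z + ereal (\<psi> Z)" for Z
        using neg[of j Z] by (simp add: enn2ereal_e2ennreal minus_ereal_def add.commute)
      ultimately show ?thesis by simp
    qed
    then show "psh_on ?D ((\<lambda>Z. mixture w \<phi> Z + ereal (\<psi> Z)) \<circ> affine_chart i)"
      using psh_on_minus_suminf[OF c _ w, of "\<lambda>j z. e2ennreal (- \<phi> j (affine_chart i z))"]
      by (simp add: o_def mixture_def minus_ereal_def add.commute)
  qed
qed

section \<open>Smooth functions\<close>

text \<open>
  Derivatives are only compared on the open set \<open>S\<close>, where equality of functions is equality of
  germs; outside, \<^const>\<open>frechet_derivative\<close> may be arbitrary.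
\<close>

lemma Ck_on_cong:
  assumes "open S" "\<And>x. x \<in> S \<Longrightarrow> f x = g x"
  shows "Ck_on k S f \<longleftrightarrow> Ck_on k S g"
  using assms(2)
proof (induction k arbitrary: f g)
  case 0
  then show ?case by (simp cong: continuous_on_cong)
next
  case (Suc k)
  have hd: "(f has_derivative D) (at x) \<longleftrightarrow> (g has_derivative D) (at x)" if "x \<in> S" for x D
    using that Suc.prems assms(1) has_derivative_transform_within_open by metis
  have "f differentiable (at x) \<longleftrightarrow> g differentiable (at x)" if "x \<in> S" for x
    using hd[OF that] by (simp add: differentiable_def)
  moreover have "frechet_derivative f (at x) = frechet_derivative g (at x)" if "x \<in> S" for x
    unfolding frechet_derivative_def using hd[OF that] by simp
  ultimately show ?case
    using Suc.IH[of "\<lambda>x. frechet_derivative f (at x) v" "\<lambda>x. frechet_derivative g (at x) v" for v]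
    by auto
qed

lemma Ck_on_SucI:
  assumes "open S" "\<And>x. x \<in> S \<Longrightarrow> (f has_derivative f' x) (at x)" "\<And>v. Ck_on k S (\<lambda>x. f' x v)"
  shows "Ck_on (Suc k) S f"
proof -
  have "frechet_derivative f (at x) = f' x" if "x \<in> S" for x
    using assms(2)[OF that] frechet_derivative_at by metis
  then have "Ck_on k S (\<lambda>x. frechet_derivative f (at x) v)" for v
    using assms(1,3) by (subst Ck_on_cong[where g = "\<lambda>x. f' x v"]) auto
  then show ?thesis using assms(2) by (auto simp: differentiable_def)
qed

lemma Ck_on_SucD:
  assumes "Ck_on (Suc k) S f"
  shows "x \<in> S \<Longrightarrow> (f has_derivative frechet_derivative f (at x)) (at x)"
    and "Ck_on k S (\<lambda>x. frechet_derivative f (at x) v)"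
  using assms by (auto simp: frechet_derivative_works)

lemma Ck_on_Suc: "Ck_on (Suc k) S f \<Longrightarrow> Ck_on k S f"
proof (induction k arbitrary: f)
  case 0
  then show ?case
    by (auto intro!: continuous_at_imp_continuous_on differentiable_imp_continuous_within)
next
  case (Suc k)
  then show ?case by (metis Ck_on.simps(2))
qed

lemma Ck_on_const: "open S \<Longrightarrow> Ck_on k S (\<lambda>x. c)"
proof (induction k arbitrary: c)
  case (Suc k)
  then show ?case by (intro Ck_on_SucI[where f' = "\<lambda>x v. 0"]) auto
qed simp

lemma Ck_on_bounded_linear:
  assumes "open S" "bounded_linear f"
  shows "Ck_on k S f"
proof (cases k)
  case 0
  then show ?thesis using assms linear_continuous_on by simp
next
  case (Suc m)
  then show ?thesis
    using assms unfolding Suc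
    by (intro Ck_on_SucI[where f' = "\<lambda>x. f"] Ck_on_const bounded_linear_imp_has_derivative)
qed

lemma Ck_on_add:
  assumes "open S" "Ck_on k S f" "Ck_on k S g"
  shows "Ck_on k S (\<lambda>x. f x + g x)"
  using assms(2,3)
proof (induction k arbitrary: f g)
  case 0
  then show ?case by (auto intro: continuous_on_add)
next
  case (Suc k)
  show ?case
    by (rule Ck_on_SucI[OF assms(1) has_derivative_add[OF Ck_on_SucD(1)[OF Suc.prems(1)]
          Ck_on_SucD(1)[OF Suc.prems(2)]]])
       (auto intro!: Suc.IH Ck_on_SucD(2)[OF Suc.prems(1)] Ck_on_SucD(2)[OF Suc.prems(2)])
qed

lemma Ck_on_mult:
  assumes "open S" "Ck_on k S f" "Ck_on k S g"
  shows "Ck_on k S (\<lambda>x. f x * g x)"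
  using assms(2,3)
proof (induction k arbitrary: f g)
  case 0
  then show ?case by (auto intro: continuous_on_mult)
next
  case (Suc k)
  show ?case
    by (rule Ck_on_SucI[OF assms(1) has_derivative_mult[OF Ck_on_SucD(1)[OF Suc.prems(1)]
          Ck_on_SucD(1)[OF Suc.prems(2)]]])
       (auto intro!: Suc.IH Ck_on_add[OF assms(1)] Ck_on_Suc[OF Suc.prems(1)] Ck_on_Suc[OF Suc.prems(2)]
          Ck_on_SucD(2)[OF Suc.prems(1)] Ck_on_SucD(2)[OF Suc.prems(2)])
qed

lemma Ck_on_sum:
  assumes "open S" "\<And>i. i \<in> I \<Longrightarrow> Ck_on k S (f i)"
  shows "Ck_on k S (\<lambda>x. \<Sum>i\<in>I. f i x)"
  using assms(2)
  by (induction I rule: infinite_finite_induct) (auto intro: Ck_on_const Ck_on_add assms(1))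

lemma Ck_on_inverse:
  assumes "open S" "Ck_on k S f" "\<And>x. x \<in> S \<Longrightarrow> f x \<noteq> 0"
  shows "Ck_on k S (\<lambda>x. inverse (f x))"
  using assms(2,3)
proof (induction k arbitrary: f)
  case 0
  then show ?case by (auto intro: continuous_on_inverse)
next
  case (Suc k)
  have I: "Ck_on k S (\<lambda>x. inverse (f x))" by (rule Suc.IH[OF Ck_on_Suc]) fact+
  have "Ck_on k S (\<lambda>x. (- 1) * (inverse (f x) * frechet_derivative f (at x) v * inverse (f x)))" for v
    by (intro Ck_on_mult Ck_on_const assms(1) I Ck_on_SucD(2)[OF Suc.prems(1)])
  then show ?case
    using Suc.prems
    by (intro Ck_on_SucI[OF assms(1) Deriv.has_derivative_inverse[OF _ Ck_on_SucD(1)[OF Suc.prems(1)]]])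
       auto
qed

text \<open>
  The derivative of \<open>ln \<circ> f\<close> involves \<open>f\<close> and its derivatives only rationally, so no
  induction is needed beyond the one for inverses.
\<close>

lemma Ck_on_ln:
  assumes "open S" "Ck_on k S f" "\<And>x. x \<in> S \<Longrightarrow> 0 < f x"
  shows "Ck_on k S (\<lambda>x. ln (f x))"
proof (cases k)
  case 0
  then show ?thesis using assms by (force intro!: continuous_on_ln)
next
  case (Suc m)
  have f: "Ck_on (Suc m) S f" using assms(2) Suc by simp
  have I: "Ck_on m S (\<lambda>x. frechet_derivative f (at x) v * inverse (f x))" for v
    using assms(3) by (intro Ck_on_mult Ck_on_inverse assms(1) Ck_on_Suc[OF f] Ck_on_SucD(2)[OF f]) force+
  show ?thesis unfolding Suc
    by (rule Ck_on_SucI[where f' = "\<lambda>x v. frechet_derivative f (at x) v * inverse (f x)"])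
       (use assms Ck_on_SucD(1)[OF f] I in \<open>auto intro!: derivative_eq_intros simp: field_simps\<close>)
qed

section \<open>The operator \<open>dd\<^sup>c\<close> on smooth functions\<close>

text \<open>
  The derivatives along \<open>v\<close> itself cancel in \<open>\<partial>\<bar>u - \<partial>u\<close>; only the derivative along \<open>\<i> *s v\<close> remains.
\<close>

lemma d_c_of_real:
  assumes "(u has_derivative u') (at z)"
  shows "d_c (\<lambda>z. complex_of_real (u z)) z v = complex_of_real (- u' (\<i> *s v) / (2 * pi))"
proof -
  have "((\<lambda>z. complex_of_real (u z)) has_derivative (\<lambda>v. complex_of_real (u' v))) (at z)"
    using assms by (rule has_derivative_of_real)
  then have "frechet_derivative (\<lambda>z. complex_of_real (u z)) (at z) = (\<lambda>v. complex_of_real (u' v))"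
    using frechet_derivative_at by metis
  then show ?thesis
    unfolding d_c_def del_def delbar_def by (simp add: field_simps)
qed

lemma dd_c_eq:
  assumes S: "open S" "z \<in> S"
    and u': "\<And>y. y \<in> S \<Longrightarrow> (u has_derivative u' y) (at y)"
    and u'': "\<And>w. ((\<lambda>y. u' y w) has_derivative u'' w) (at z)"
  shows "dd_c u z v w = complex_of_real ((u'' (\<i> *s v) w - u'' (\<i> *s w) v) / (2 * pi))"
proof -
  have "frechet_derivative (\<lambda>y. d_c (\<lambda>z. complex_of_real (u z)) y w) (at z) =
      (\<lambda>v. complex_of_real (- u'' (\<i> *s w) v / (2 * pi)))" for w
  proof -
    have "((\<lambda>y. complex_of_real (- u' y (\<i> *s w) / (2 * pi))) has_derivative
        (\<lambda>v. complex_of_real (- u'' (\<i> *s w) v / (2 * pi)))) (at z)"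
      using u'' by (auto intro!: derivative_eq_intros)
    then have "((\<lambda>y. d_c (\<lambda>z. complex_of_real (u z)) y w) has_derivative
        (\<lambda>v. complex_of_real (- u'' (\<i> *s w) v / (2 * pi)))) (at z)"
      by (rule has_derivative_transform_within_open[OF _ S]) (simp add: d_c_of_real[OF u'])
    then show ?thesis using frechet_derivative_at by metis
  qed
  then show ?thesis
    unfolding dd_c_def ext_d_def by (simp add: diff_divide_distrib)
qed

lemma dd_c_diff:
  assumes S: "open S" "z \<in> S" and f: "Ck_on 2 S f" and h: "Ck_on 2 S h"
    and g: "\<And>y. y \<in> S \<Longrightarrow> g y = f y - h y"
  shows "dd_c g z v w = dd_c f z v w - dd_c h z v w"
proof -
  have f2: "Ck_on (Suc (Suc 0)) S f" and h2: "Ck_on (Suc (Suc 0)) S h"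
    using f h by (simp_all add: numeral_2_eq_2)
  note D = Ck_on_SucD(1)[OF f2] Ck_on_SucD(1)[OF h2]
    Ck_on_SucD(1)[OF Ck_on_SucD(2)[OF f2] S(2)] Ck_on_SucD(1)[OF Ck_on_SucD(2)[OF h2] S(2)]
  have g': "(g has_derivative (\<lambda>v. frechet_derivative f (at y) v - frechet_derivative h (at y) v)) (at y)"
    if "y \<in> S" for y
    by (rule has_derivative_transform_within_open[OF has_derivative_diff[OF D(1,2)] S(1)])
       (use that g in auto)
  show ?thesis
    by (simp add: diff_divide_distrib dd_c_eq[OF S D(1) D(3)] dd_c_eq[OF S D(2) D(4)]
        dd_c_eq[OF S g' has_derivative_diff[OF D(3,4)]])
qed

text \<open>
  Pluriharmonicity of \<open>ln |l|\<close> for a complex affine \<open>l\<close> away from its zeros. Its derivative at \<open>y\<close> along \<open>v\<close> is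
  \<open>Re (L v / l y)\<close>; differentiating again, with \<open>\<i> *s v\<close> inserted in one slot, gives
  \<open>Re (- \<i> L v L w / (l y)\<^sup>2)\<close>, which is symmetric in \<open>v\<close> and \<open>w\<close>, so the antisymmetrisation \<open>dd\<^sup>c\<close>
  vanishes.
\<close>

lemma dd_c_ln_cmod_affine:
  fixes L :: "complex ^ 'n \<Rightarrow> complex"
  assumes L: "bounded_linear L" "\<And>v. L (\<i> *s v) = \<i> * L v" and z: "a + L z \<noteq> 0"
  shows "dd_c (\<lambda>y. ln (cmod (a + L y))) z v w = 0"
proof -
  define S where "S = {y. a + L y \<noteq> 0}"
  have "open S" unfolding S_def
    by (intro open_Collect_neq continuous_intros linear_continuous_on L)
  note S = this z[folded mem_Collect_eq[of z "\<lambda>y. a + L y \<noteq> 0"], folded S_def]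
  have l: "(L has_derivative L) (at y)" for y
    by (rule bounded_linear_imp_has_derivative[OF L(1)])
  have u': "((\<lambda>y. ln (cmod (a + L y))) has_derivative (\<lambda>v. Re (L v / (a + L y)))) (at y)"
    if "y \<in> S" for y
  proof -
    have nz: "a + L y \<noteq> 0" using that S_def by simp
    have "((\<lambda>y. cmod (a + L y)) has_derivative (\<lambda>v. inner (sgn (a + L y)) (L v))) (at y)"
      using has_derivative_compose[OF has_derivative_add[OF has_derivative_const l, of a] has_derivative_norm] nz
      by (simp add: inner_commute)
    then have "((\<lambda>y. ln (cmod (a + L y))) has_derivative
        (\<lambda>v. inner (sgn (a + L y)) (L v) * inverse (cmod (a + L y)))) (at y)"
      using nz by (auto intro!: derivative_eq_intros simp: divide_inverse)
    moreover have "inner (sgn x) t * inverse (cmod x) = Re (t / x)" for x t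
    proof -
      have "Re (t / x) = Re (t * cnj x) / (cmod x)\<^sup>2"
        unfolding complex_div_cnj[of t x] of_real_power[symmetric] Re_divide_of_real ..
      then show ?thesis
        by (simp add: sgn_div_norm inner_complex_def power2_eq_square field_simps add_divide_distrib)
    qed
    ultimately show ?thesis by simp
  qed
  have u'': "((\<lambda>y. Re (L w / (a + L y))) has_derivative (\<lambda>v. Re (- (L w * L v) / (a + L z)\<^sup>2))) (at z)" for w
    using z l by (auto intro!: derivative_eq_intros simp: field_simps power2_eq_square)
  show ?thesis
    by (subst dd_c_eq[OF S u' u'']) (simp_all add: L(2) mult_ac)
qed

section \<open>Charts and potentials on projective space\<close>

text \<open>
  In a chart every homogeneous coordinate is complex affine (in fact constant or a coordinate).
  This form treats all combinations of chart and coordinate uniformly.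
\<close>

lemma affine_lift_nth_affine:
  obtains L :: "complex ^ 'n \<Rightarrow> complex" and a
  where "bounded_linear L" "\<And>v. L (\<i> *s v) = \<i> * L v" "\<And>z. affine_lift i z $ k = a + L z"
proof (cases "k = i")
  case True
  then show thesis by (intro that[of "\<lambda>_. 0" 1]) (auto simp: affine_lift_def)
next
  case False
  define j where "j = (case k of None \<Rightarrow> the i | Some j \<Rightarrow> j)"
  show thesis
    using False by (intro that[of "\<lambda>z. z $ j" 0])
      (auto simp: affine_lift_def j_def bounded_linear_vec_nth split: option.split)
qed

lemma affine_lift_nonzero: "affine_lift i z \<noteq> 0"
proof
  assume "affine_lift i z = 0"
  then have "affine_lift i z $ i = 0" by simp
  then show False by (simp add: affine_lift_def)
qed

lemma continuous_on_affine_lift: "continuous_on S (affine_lift i)"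
proof -
  have "continuous_on S (\<lambda>z. affine_lift i z $ k)" for k
  proof -
    obtain L a where L: "bounded_linear L" "\<And>v. L (\<i> *s v) = \<i> * L v" "\<And>z. affine_lift i z $ k = a + (L z :: complex)"
      using affine_lift_nth_affine[of i k] by blast
    show ?thesis unfolding L(3) by (intro continuous_intros linear_continuous_on L)
  qed
  then have "continuous_on S (\<lambda>z. \<chi> k. affine_lift i z $ k)" by (rule continuous_on_vec_lambda)
  then show ?thesis by simp
qed

lemma open_affine_chart_vimage:
  assumes "open U"
  shows "open (affine_chart i -` U)"
proof -
  have "affine_chart i -` U = affine_lift i -` {Z. Z \<noteq> 0 \<and> to_proj Z \<in> U}"
    using affine_lift_nonzero by (auto simp: affine_chart_def)
  moreover have "open \<dots>"
    using assms continuous_on_affine_lift[of UNIV i] unfolding open_cproj_def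
    by (auto simp: continuous_on_open_vimage simp del: vimage_Collect_eq)
  ultimately show ?thesis by simp
qed

lemma complex_line_eq_iff:
  assumes "Z \<noteq> 0"
  shows "complex_line Z = complex_line W \<longleftrightarrow> (\<exists>c. c \<noteq> 0 \<and> W = c *s Z)"
proof
  assume eq: "complex_line Z = complex_line W"
  have mem: "X \<in> complex_line X" for X :: "complex ^ 'a"
    using rangeI[of "\<lambda>c. c *s X" 1] by (simp add: complex_line_def)
  have "W \<in> complex_line Z" "Z \<in> complex_line W" using mem eq by auto
  then obtain c d where "W = c *s Z" "Z = d *s W" unfolding complex_line_def by blast
  moreover have "c \<noteq> 0" using calculation assms by auto
  ultimately show "\<exists>c. c \<noteq> 0 \<and> W = c *s Z" by blast
next
  assume "\<exists>c. c \<noteq> 0 \<and> W = c *s Z"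
  then obtain c where c: "c \<noteq> 0" "W = c *s Z" by blast
  have "d *s Z = (d / c) *s W" "d *s W = (d * c) *s Z" for d
    using c by (simp_all add: vector_smult_assoc)
  then have "d *s Z \<in> complex_line W" "d *s W \<in> complex_line Z" for d
    unfolding complex_line_def by (blast intro: range_eqI)+
  then show "complex_line Z = complex_line W"
    by (auto simp: complex_line_def)
qed

lemma to_proj_eq_iff:
  assumes "Z \<noteq> 0" "W \<noteq> 0"
  shows "to_proj Z = to_proj W \<longleftrightarrow> (\<exists>c. c \<noteq> 0 \<and> W = c *s Z)"
proof -
  have "to_proj Z = to_proj W \<longleftrightarrow> complex_line Z = complex_line W"
    unfolding to_proj_def by (rule Abs_cproj_inject) (use assms in blast)+
  then show ?thesis using complex_line_eq_iff[OF assms(1)] by simp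
qed

lemma to_proj_surj: obtains Z where "Z \<noteq> 0" "P = to_proj Z"
  by (cases P) (auto simp: to_proj_def)

text \<open>
  The function \<open>ln (|Z| / |Z\<^sub>i|)\<close>, which is homogeneous of degree 0.
\<close>

definition potential :: "'n option \<Rightarrow> ('n::finite) cproj \<Rightarrow> real"
  where "potential i P = (let Z = SOME Z. Z \<noteq> 0 \<and> to_proj Z = P in ln (norm Z / cmod (Z $ i)))"

lemma norm_smult_vec: "norm (c *s Z) = cmod c * norm (Z :: complex ^ 'm)"
  by (simp add: norm_vec_def norm_mult L2_set_right_distrib)

lemma potential_to_proj:
  assumes "Z \<noteq> 0"
  shows "potential i (to_proj Z) = ln (norm Z / cmod (Z $ i))"
proof -
  define W where "W = (SOME W. W \<noteq> 0 \<and> to_proj W = to_proj Z)"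
  have "W \<noteq> 0 \<and> to_proj W = to_proj Z"
    unfolding W_def by (rule someI[of _ Z]) (use assms in simp)
  then obtain c where "c \<noteq> 0" "W = c *s Z"
    using to_proj_eq_iff[of Z W] assms by metis
  then show ?thesis
    unfolding potential_def W_def[symmetric] Let_def by (simp add: norm_smult_vec norm_mult)
qed

definition chart_domain :: "'n option \<Rightarrow> ('n::finite) cproj set"
  where "chart_domain i = to_proj ` {Z. Z $ i \<noteq> 0}"

lemma to_proj_in_chart_domain_iff:
  assumes "Z \<noteq> 0"
  shows "to_proj Z \<in> chart_domain i \<longleftrightarrow> Z $ i \<noteq> 0"
proof
  assume "to_proj Z \<in> chart_domain i"
  then obtain W where W: "W $ i \<noteq> 0" "to_proj Z = to_proj W" unfolding chart_domain_def by auto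
  then have "W \<noteq> 0" by auto
  then obtain c where "W = c *s Z" using to_proj_eq_iff[OF assms] W by blast
  then show "Z $ i \<noteq> 0" using W by auto
next
  assume "Z $ i \<noteq> 0"
  then show "to_proj Z \<in> chart_domain i" unfolding chart_domain_def by blast
qed

lemma open_chart_domain: "open (chart_domain i)"
proof -
  have "{Z. Z \<noteq> 0 \<and> to_proj Z \<in> chart_domain i} = {Z. Z $ i \<noteq> 0}"
  proof (intro Collect_cong)
    fix Z :: "complex ^ 'a option"
    show "Z \<noteq> 0 \<and> to_proj Z \<in> chart_domain i \<longleftrightarrow> Z $ i \<noteq> 0"
      by (cases "Z = 0") (simp_all add: to_proj_in_chart_domain_iff)
  qed
  moreover have "open {Z :: complex ^ 'a option. Z $ i \<noteq> 0}"
    by (intro open_Collect_neq continuous_intros)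
  ultimately show ?thesis unfolding open_cproj_def by simp
qed

text \<open>
  Both logarithms are halves of logarithms of sums of squares of real affine functions; this
  avoids differentiating norms.
\<close>

lemma Ck_on_ln_affine_lift:
  assumes S: "open S"
  shows "Ck_on k S (\<lambda>z. ln (norm (affine_lift i z)))"
    and "(\<And>z. z \<in> S \<Longrightarrow> affine_lift i z $ l \<noteq> 0) \<Longrightarrow> Ck_on k S (\<lambda>z. ln (cmod (affine_lift i z $ l)))"
proof -
  have sq: "Ck_on k S (\<lambda>z. (cmod (affine_lift i z $ l))\<^sup>2)" for l
  proof -
    obtain L a where L: "bounded_linear L" "\<And>v. L (\<i> *s v) = \<i> * L v" "\<And>z. affine_lift i z $ l = a + (L z :: complex)"
      using affine_lift_nth_affine[of i l] by blast
    show ?thesis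
      unfolding cmod_power2
      unfolding power2_eq_square L(3) plus_complex.sel
      by (intro Ck_on_add Ck_on_mult Ck_on_const Ck_on_bounded_linear S
          bounded_linear_compose[OF bounded_linear_Re L(1)] bounded_linear_compose[OF bounded_linear_Im L(1)])
  qed
  have half: "Ck_on k S (\<lambda>z. 1 / 2 * ln (f z))" if "Ck_on k S f" "\<And>z. z \<in> S \<Longrightarrow> 0 < f z" for f
    by (intro Ck_on_mult Ck_on_const Ck_on_ln S that)
  have ln_eq: "ln (x\<^sup>2) / 2 = ln x" if "0 < x" for x :: real
    using that by (simp add: ln_realpow)
  have norm_eq: "(\<Sum>l\<in>UNIV. (cmod (affine_lift i z $ l))\<^sup>2) = (norm (affine_lift i z))\<^sup>2" for z
    by (simp add: norm_vec_def L2_set_def sum_nonneg)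
  have "Ck_on k S (\<lambda>z. (norm (affine_lift i z))\<^sup>2)"
    unfolding norm_eq[symmetric] by (intro Ck_on_sum S sq)
  from half[OF this] show "Ck_on k S (\<lambda>z. ln (norm (affine_lift i z)))"
    using affine_lift_nonzero[of i] by (simp add: ln_eq)
  show "Ck_on k S (\<lambda>z. ln (cmod (affine_lift i z $ l)))" if "\<And>z. z \<in> S \<Longrightarrow> affine_lift i z $ l \<noteq> 0"
    using half[OF sq[of l]] that
      Ck_on_cong[OF S, of "\<lambda>z. 1 / 2 * ln ((cmod (affine_lift i z $ l))\<^sup>2)" "\<lambda>z. ln (cmod (affine_lift i z $ l))"]
    by (simp add: ln_eq)
qed

text \<open>
  In chart \<open>j\<close> the potential differs from the function \<open>ln |Z|\<close> defining the Fubini--Study form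
  by \<open>ln |Z\<^sub>i|\<close>, which is pluriharmonic where \<open>Z\<^sub>i\<close> does not vanish.
\<close>

lemma omega_potential_on_potential: "omega_potential_on (chart_domain i) (potential i)"
proof -
  define D where "D j = affine_chart j -` chart_domain i" for j
  have D: "open (D j)" "\<And>z. z \<in> D j \<Longrightarrow> affine_lift j z $ i \<noteq> 0" for j
    using open_affine_chart_vimage[OF open_chart_domain, of j i]
      to_proj_in_chart_domain_iff[OF affine_lift_nonzero, of j _ i]
    by (auto simp: D_def affine_chart_def)
  have eq: "(potential i \<circ> affine_chart j) z = ln (norm (affine_lift j z)) - ln (cmod (affine_lift j z $ i))"
    if "z \<in> D j" for j z
    using D(2)[OF that] affine_lift_nonzero[of j z]
    by (simp add: affine_chart_def potential_to_proj ln_div)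
  have Ck: "Ck_on k (D j) (\<lambda>z. ln (cmod (affine_lift j z $ i)))" for j k
    by (intro Ck_on_ln_affine_lift D)
  have "Ck_on k (D j) (\<lambda>z. ln (norm (affine_lift j z)) + (- 1) * ln (cmod (affine_lift j z $ i)))" for j k
    by (intro Ck_on_add Ck_on_mult Ck_on_const Ck Ck_on_ln_affine_lift D)
  then have "Ck_on k (D j) (potential i \<circ> affine_chart j)" for j k
    using Ck_on_cong[OF D(1), of j "potential i \<circ> affine_chart j"
        "\<lambda>z. ln (norm (affine_lift j z)) + (- 1) * ln (cmod (affine_lift j z $ i))" k] eq[of _ j] by simp
  then have "smooth_on_proj (chart_domain i) (potential i)"
    unfolding smooth_on_proj_def smooth_on_def D_def by blast
  moreover have "dd_c (potential i \<circ> affine_chart j) z = fubini_study j z" if z: "z \<in> D j" for j z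
  proof (intro ext)
    fix v w
    obtain L a where L: "bounded_linear L" "\<And>v. L (\<i> *s v) = \<i> * L v"
        "\<And>z. affine_lift j z $ i = a + (L z :: complex)"
      using affine_lift_nth_affine[of j i] by blast
    have "dd_c (\<lambda>z. ln (cmod (affine_lift j z $ i))) z v w = 0"
      using D(2)[OF z] unfolding L(3) by (intro dd_c_ln_cmod_affine L(1,2))
    then show "dd_c (potential i \<circ> affine_chart j) z v w = fubini_study j z v w"
      using dd_c_diff[OF D(1) z Ck_on_ln_affine_lift(1)[OF D(1)] Ck eq] by (simp add: fubini_study_def o_def)
  qed
  ultimately show ?thesis unfolding omega_potential_on_def D_def by blast
qed

section \<open>Upper bounds for \<open>\<omega>\<close>-plurisubharmonic functions\<close>

lemma omega_potential_on_diff_const: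
  assumes "open U" "omega_potential_on U \<psi>"
  shows "omega_potential_on U (\<lambda>Z. \<psi> Z - C)"
proof -
  define D where "D j = affine_chart j -` U" for j
  have D: "open (D j)" for j unfolding D_def by (rule open_affine_chart_vimage) fact
  have Ck: "Ck_on k (D j) (\<psi> \<circ> affine_chart j)" for j k
    using assms(2) unfolding omega_potential_on_def smooth_on_proj_def smooth_on_def D_def by blast
  have "Ck_on k (D j) (\<lambda>z. (\<psi> \<circ> affine_chart j) z + (- C))" for j k
    by (intro Ck_on_add Ck_on_const Ck D)
  moreover have "dd_c ((\<lambda>Z. \<psi> Z - C) \<circ> affine_chart j) z = fubini_study j z" if z: "z \<in> D j" for j z
  proof (intro ext)
    fix v w
    have "dd_c (\<lambda>z. C) z v w = 0"
      using dd_c_eq[OF D z, of "\<lambda>_. C" "\<lambda>_ _. 0" "\<lambda>_ _. 0"] by simp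
    then show "dd_c ((\<lambda>Z. \<psi> Z - C) \<circ> affine_chart j) z v w = fubini_study j z v w"
      using dd_c_diff[OF D z Ck Ck_on_const[OF D], of "(\<lambda>Z. \<psi> Z - C) \<circ> affine_chart j" C] z assms(2)
      by (simp add: omega_potential_on_def D_def)
  qed
  ultimately show ?thesis
    unfolding omega_potential_on_def smooth_on_proj_def smooth_on_def D_def o_def by simp
qed

text \<open>
  The constant is moved into the test potential, which stays a potential.
\<close>

lemma PSH_omega_diff_const:
  fixes \<phi> :: "('n::finite) cproj \<Rightarrow> ereal"
  assumes "\<phi> \<in> PSH_omega"
  shows "(\<lambda>Z. \<phi> Z - ereal C) \<in> PSH_omega"
  unfolding PSH_omega_def mem_Collect_eq
proof (intro conjI allI impI)
  fix Z show "\<phi> Z - ereal C \<noteq> \<infinity>"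
    using assms unfolding PSH_omega_def by (cases "\<phi> Z") auto
next
  fix U and \<psi> :: "'n cproj \<Rightarrow> real" assume U: "open U \<and> omega_potential_on U \<psi>"
  then have "psh_on_proj U (\<lambda>Z. \<phi> Z + ereal (\<psi> Z - C))"
    using assms omega_potential_on_diff_const[of U \<psi> C] unfolding PSH_omega_def by blast
  moreover have "\<phi> Z + ereal (\<psi> Z - C) = \<phi> Z - ereal C + ereal (\<psi> Z)" for Z
    by (cases "\<phi> Z") auto
  ultimately show "psh_on_proj U (\<lambda>Z. \<phi> Z - ereal C + ereal (\<psi> Z))" by simp
qed

text \<open>
  Normalising by a coordinate of maximal modulus shows that the closed unit polydiscs of the
  charts cover projective space. This replaces a proof of its compactness.
\<close>

lemma affine_chart_polydisc:
  obtains i z where "P = affine_chart i z" "\<And>k. cmod (z $ k) \<le> 1"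
proof -
  obtain Z where Z: "Z \<noteq> 0" "P = to_proj Z" by (rule to_proj_surj)
  have "Max (range (\<lambda>k. cmod (Z $ k))) \<in> range (\<lambda>k. cmod (Z $ k))" by (rule Max_in) auto
  then obtain i where "Max (range (\<lambda>k. cmod (Z $ k))) = cmod (Z $ i)" by blast
  then have i: "cmod (Z $ k) \<le> cmod (Z $ i)" for k
    using Max_ge[of "range (\<lambda>k. cmod (Z $ k))" "cmod (Z $ k)"] by simp
  have "Z $ i \<noteq> 0"
  proof
    assume "Z $ i = 0"
    then have "Z $ k = 0" for k using i[of k] by simp
    then show False using Z(1) by (simp add: vec_eq_iff)
  qed
  define z where "z = (\<chi> j. Z $ (if i = Some j then None else Some j) / Z $ i)"
  have "affine_lift i z $ k = (inverse (Z $ i) *s Z) $ k" for k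
    using \<open>Z $ i \<noteq> 0\<close> by (cases i; cases k) (auto simp: affine_lift_def z_def field_simps)
  then have "affine_lift i z = inverse (Z $ i) *s Z" by (simp add: vec_eq_iff)
  then have "\<exists>c. c \<noteq> 0 \<and> affine_lift i z = c *s Z"
    using \<open>Z $ i \<noteq> 0\<close> nonzero_imp_inverse_nonzero by blast
  then have "P = affine_chart i z"
    unfolding Z(2) affine_chart_def to_proj_eq_iff[OF Z(1) affine_lift_nonzero] .
  moreover have "cmod (z $ k) \<le> 1" for k
    using i \<open>Z $ i \<noteq> 0\<close> by (simp add: z_def norm_divide)
  ultimately show thesis by (rule that)
qed

lemma usc_on_compact_bounded_above:
  assumes K: "compact K" and u: "usc_on K u" "\<And>x. x \<in> K \<Longrightarrow> u x \<noteq> \<infinity>"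
  obtains C :: real where "\<And>x. x \<in> K \<Longrightarrow> u x \<le> ereal C"
proof -
  define V where "V n = {x \<in> K. u x < ereal (real n)}" for n :: nat
  have "openin (top_of_set K) (V n)" for n using u(1) unfolding V_def usc_on_def by blast
  then obtain T where T: "\<And>n. open (T n)" "\<And>n. V n = K \<inter> T n" unfolding openin_open by metis
  have "K \<subseteq> (\<Union>n\<in>UNIV. T n)"
  proof
    fix x assume x: "x \<in> K"
    then obtain n :: nat where "u x < ereal (real n)"
      using u(2)[OF x] less_PInf_Ex_of_nat by blast
    then show "x \<in> (\<Union>n\<in>UNIV. T n)" using T(2) x unfolding V_def by blast
  qed
  then obtain N where N: "N \<subseteq> UNIV" "finite N" "K \<subseteq> (\<Union>n\<in>N. T n)"
    by (rule compactE_image[OF K T(1)])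
  have "u x \<le> ereal (real (Max N))" if "x \<in> K" for x
  proof -
    obtain n where "n \<in> N" "x \<in> V n" using N(3) T(2) \<open>x \<in> K\<close> by blast
    then have "u x < ereal (real n)" "n \<le> Max N" using N(2) by (auto simp: V_def)
    note this(1)
    also have "ereal (real n) \<le> ereal (real (Max N))" using \<open>n \<le> Max N\<close> by simp
    finally show ?thesis by (rule less_imp_le)
  qed
  then show thesis by (rule that)
qed

text \<open>
  On each of the finitely many polydiscs that cover the space, \<open>\<phi>\<close> plus the potential is upper
  semicontinuous, hence bounded above; the potential itself is nonnegative there.
\<close>

lemma PSH_omega_bounded_above:
  assumes "\<phi> \<in> PSH_omega"
  obtains C :: real where "\<And>Z. \<phi> Z \<le> ereal C"
proof -
  let ?K = "{z :: complex ^ 'a. \<forall>k. cmod (z $ k) \<le> 1}"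
  have "closed ?K" by (rule closed_Collect_all, rule closed_Collect_le) (intro continuous_intros)+
  moreover have "bounded ?K"
  proof (rule boundedI)
    fix z :: "complex ^ 'a" assume "z \<in> ?K"
    have "norm z \<le> (\<Sum>k\<in>UNIV. cmod (z $ k))"
      unfolding norm_vec_def by (rule L2_set_le_sum) simp
    also have "\<dots> \<le> (\<Sum>k\<in>(UNIV :: 'a set). 1)" using \<open>z \<in> ?K\<close> by (intro sum_mono) simp
    finally show "norm z \<le> (\<Sum>k\<in>(UNIV :: 'a set). 1)" .
  qed
  ultimately have K: "compact ?K" by (simp add: compact_eq_bounded_closed)
  have "\<exists>C :: real. \<forall>z\<in>?K. \<phi> (affine_chart i z) \<le> ereal C" for i
  proof -
    have dom: "affine_chart i -` chart_domain i = UNIV"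
      using to_proj_in_chart_domain_iff[OF affine_lift_nonzero, of i _ i]
      by (auto simp: affine_chart_def affine_lift_def)
    have "psh_on_proj (chart_domain i) (\<lambda>Z. \<phi> Z + ereal (potential i Z))"
      using assms open_chart_domain omega_potential_on_potential unfolding PSH_omega_def by blast
    then have psh: "psh_on UNIV (\<lambda>z. \<phi> (affine_chart i z) + ereal (potential i (affine_chart i z)))" (is "psh_on _ ?u")
      unfolding psh_on_proj_def o_def using dom by metis
    obtain C :: real where C: "\<And>z. z \<in> ?K \<Longrightarrow> ?u z \<le> ereal C"
    proof (rule usc_on_compact_bounded_above[OF K])
      show "usc_on ?K ?u"
        by (rule usc_on_compose[of UNIV ?u ?K "\<lambda>x. x"]) (use psh in \<open>auto simp: psh_on_def\<close>)
      show "?u z \<noteq> \<infinity>" for z using psh unfolding psh_on_def by blast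
    qed blast
    \<comment> \<open>The lift has \<open>i\<close>-th coordinate 1, so its norm is at least 1.\<close>
    have "0 \<le> potential i (affine_chart i z)" for z
    proof -
      have "cmod (affine_lift i z $ i) = 1" by (simp add: affine_lift_def)
      then show ?thesis
        using Finite_Cartesian_Product.norm_nth_le[of "affine_lift i z" i] affine_lift_nonzero[of i z]
        by (simp add: affine_chart_def potential_to_proj)
    qed
    then have "\<phi> (affine_chart i z) \<le> ?u z" for z
      by (simp add: add_increasing2)
    then show ?thesis using C order_trans by blast
  qed
  then obtain C :: "'a option \<Rightarrow> real" where C: "\<And>i z. z \<in> ?K \<Longrightarrow> \<phi> (affine_chart i z) \<le> ereal (C i)"
    by metis
  have "\<phi> Z \<le> ereal (Max (range C))" for Z
  proof -
    obtain i z where "Z = affine_chart i z" "z \<in> ?K" using affine_chart_polydisc[of Z] by blast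
    then have "\<phi> Z \<le> ereal (C i)" using C by simp
    also have "\<dots> \<le> ereal (Max (range C))" by simp
    finally show ?thesis .
  qed
  then show thesis by (rule that)
qed

section \<open>The extremal function and the hull\<close>

definition competitors :: "real \<Rightarrow> ('n::finite) cproj set \<Rightarrow> ('n cproj \<Rightarrow> ereal) set"
  where "competitors s E = {\<phi> \<in> PSH_omega. \<forall>W. \<phi> W \<le> ereal (- s * indicator E W)}"

lemma extremal_eq_SUP: "extremal Z s E = (SUP \<phi>\<in>competitors s E. \<phi> Z)"
  unfolding extremal_def competitors_def ..

lemma competitors_iff:
  "\<phi> \<in> competitors s E \<longleftrightarrow> \<phi> \<in> PSH_omega \<and> (\<forall>Z\<in>E. \<phi> Z \<le> ereal (- s)) \<and> (\<forall>Z\<in>-E. \<phi> Z \<le> 0)"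
  unfolding competitors_def by (auto simp: indicator_def zero_ereal_def)

lemma competitors_le_zero:
  assumes "\<phi> \<in> competitors s E" "0 \<le> s"
  shows "\<phi> Z \<le> 0"
proof (cases "Z \<in> E")
  case True
  then have "\<phi> Z \<le> ereal (- s)" using assms unfolding competitors_iff by blast
  also have "\<dots> \<le> 0" using assms(2) by (simp add: zero_ereal_def)
  finally show ?thesis .
qed (use assms in \<open>auto simp: competitors_iff\<close>)

lemma competitors_antimono:
  assumes "s \<le> t"
  shows "competitors t E \<subseteq> competitors s E"
proof -
  have "x \<le> ereal (- t) \<Longrightarrow> x \<le> ereal (- s)" for x
    by (erule order_trans) (use assms in simp)
  then show ?thesis by (auto simp: competitors_iff)
qed

text \<open>
  A mixture with only two nonzero weights.
\<close>

lemma PSH_omega_convex_combination: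
  assumes \<phi>: "\<phi> \<in> PSH_omega" "\<And>Z. \<phi> Z \<le> 0" and \<phi>': "\<phi>' \<in> PSH_omega" "\<And>Z. \<phi>' Z \<le> 0"
    and t: "0 < t" "t < 1"
  shows "(\<lambda>Z. ereal (1 - t) * \<phi> Z + ereal t * \<phi>' Z) \<in> PSH_omega"
proof -
  define w where "w j = (if j = 0 then 1 - t else if j = 1 then t else 0)" for j :: nat
  define \<theta> where "\<theta> j = (if j = 0 then \<phi> else \<phi>')" for j :: nat
  have two: "(\<Sum>j. f j) = f 0 + f 1" if "\<And>j. j \<notin> {0, 1} \<Longrightarrow> f j = 0" for f :: "nat \<Rightarrow> ennreal"
    using suminf_finite[of "{0, 1 :: nat}" f] that by simp
  have "(\<Sum>j. ennreal (w j)) = 1"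
    using t by (subst two) (auto simp: w_def ennreal_plus[symmetric] simp del: ennreal_plus)
  then have "mixture w \<theta> \<in> PSH_omega"
    using \<phi> \<phi>' by (intro mixture_in_PSH_omega) (auto simp: \<theta>_def)
  moreover have "mixture w \<theta> Z = ereal (1 - t) * \<phi> Z + ereal t * \<phi>' Z" for Z
  proof -
    have "mixture w \<theta> Z =
        - enn2ereal (ennreal (1 - t) * e2ennreal (- \<phi> Z) + ennreal t * e2ennreal (- \<phi>' Z))"
      unfolding mixture_def by (subst two) (auto simp: w_def \<theta>_def)
    also have "\<dots> = - (ereal (1 - t) * - \<phi> Z + ereal t * - \<phi>' Z)"
      using t \<phi>(2)[of Z] \<phi>'(2)[of Z]
      by (simp add: plus_ennreal.rep_eq times_ennreal.rep_eq enn2ereal_e2ennreal enn2ereal_ennreal)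
    also have "\<dots> = ereal (1 - t) * \<phi> Z + ereal t * \<phi>' Z"
      using t \<phi>(2)[of Z] \<phi>'(2)[of Z] by (cases "\<phi> Z"; cases "\<phi>' Z") auto
    finally show ?thesis .
  qed
  then have "mixture w \<theta> = (\<lambda>Z. ereal (1 - t) * \<phi> Z + ereal t * \<phi>' Z)" by (rule ext)
  ultimately show ?thesis by simp
qed

text \<open>
  Concavity at work: for \<open>s2 < r\<close> a competitor for \<open>r\<close> is combined with a fixed good competitor for
  \<open>s1\<close> into a competitor for \<open>s2\<close>, whose value at \<open>Z\<close> is bounded by the extremal function at \<open>s2\<close>.
  If \<open>a\<close> is the value at \<open>Z\<close> of the fixed competitor and \<open>b < a\<close> a bound for the extremal function at
  \<open>s2\<close>, then the value at \<open>Z\<close> of every competitor for \<open>r\<close> lies below the line through \<open>(s1, a)\<close> and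
  \<open>(s2, b)\<close>, which has negative slope.
\<close>

lemma extremal_linear_decay:
  assumes s: "0 \<le> s1" "s1 < s2" and less: "extremal Z s2 E < extremal Z s1 E"
  obtains \<mu> \<beta> where "0 < \<mu>" "0 < \<beta>" "Z \<in> decay_set E \<mu> \<beta>"
proof -
  obtain \<phi> where \<phi>: "\<phi> \<in> competitors s1 E" "extremal Z s2 E < \<phi> Z"
    using less unfolding extremal_eq_SUP[of Z s1] less_SUP_iff by blast
  have le0: "\<phi> W \<le> 0" for W using competitors_le_zero[OF \<phi>(1) s(1)] .
  obtain b where b: "extremal Z s2 E < ereal b" "ereal b < \<phi> Z" using ereal_dense2[OF \<phi>(2)] by blast
  obtain a where a: "\<phi> Z = ereal a" using b(2) le0[of Z] by (cases "\<phi> Z") auto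
  have ab: "a \<le> 0" "b < a" using le0[of Z] b(2) a by (auto simp: zero_ereal_def)
  \<comment> \<open>The slope of the line is \<open>- 1 / \<mu>\<close>. The constant \<open>\<beta>\<close> makes the bound nonnegative up to \<open>s2\<close>, where only \<open>\<sigma> \<le> 0\<close> is used.\<close>
  define \<mu> where "\<mu> = (s2 - s1) / (a - b)"
  define \<beta> where "\<beta> = s2 / \<mu>"
  have pos: "0 < \<mu>" "0 < \<beta>" using s ab by (simp_all add: \<mu>_def \<beta>_def)
  have "\<theta> Z \<le> ereal (\<beta> - 1 / \<mu> * r)" if r: "0 < r" and \<theta>: "\<theta> \<in> competitors r E" for r \<theta>
  proof (cases "r \<le> s2")
    case True
    have "\<theta> Z \<le> 0" using competitors_le_zero[OF \<theta>] r by simp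
    also have "0 \<le> ereal (\<beta> - 1 / \<mu> * r)"
      using True pos by (simp add: \<beta>_def divide_right_mono zero_ereal_def)
    finally show ?thesis .
  next
    case False
    \<comment> \<open>The weight that places \<open>s2\<close> between \<open>s1\<close> and \<open>r\<close>.\<close>
    define t where "t = (s2 - s1) / (r - s1)"
    have t: "0 < t" "t < 1" using False s by (auto simp: t_def)
    have ts: "(1 - t) * s1 + t * r = s2"
    proof -
      have "t * (r - s1) = s2 - s1" using False s by (simp add: t_def)
      then show ?thesis by (simp add: algebra_simps)
    qed
    have \<theta>0: "\<theta> W \<le> 0" for W using competitors_le_zero[OF \<theta>] r by simp
    let ?\<kappa> = "\<lambda>W. ereal (1 - t) * \<phi> W + ereal t * \<theta> W"
    have "?\<kappa> \<in> competitors s2 E"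
      unfolding competitors_iff
    proof (intro conjI ballI)
      show "?\<kappa> \<in> PSH_omega"
        using \<phi>(1) \<theta> le0 \<theta>0 t by (intro PSH_omega_convex_combination) (auto simp: competitors_iff)
    next
      fix W assume "W \<in> E"
      then have "\<phi> W \<le> ereal (- s1)" "\<theta> W \<le> ereal (- r)"
        using \<phi>(1) \<theta> unfolding competitors_iff by blast+
      then have "?\<kappa> W \<le> ereal (1 - t) * ereal (- s1) + ereal t * ereal (- r)"
        using t by (intro add_mono ereal_mult_left_mono) auto
      also have "\<dots> = ereal (- s2)" using ts by (simp add: algebra_simps)
      finally show "?\<kappa> W \<le> ereal (- s2)" .
    next
      fix W
      show "?\<kappa> W \<le> 0"
        using t le0[of W] \<theta>0[of W] by (cases "\<phi> W"; cases "\<theta> W") (auto simp: zero_ereal_def mult_nonneg_nonpos add_nonpos_nonpos)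
    qed
    then have "?\<kappa> Z \<le> extremal Z s2 E" unfolding extremal_eq_SUP by (rule SUP_upper)
    then have "ereal (1 - t) * ereal a + ereal t * \<theta> Z \<le> ereal b" using b(1) a by simp
    then show ?thesis
    proof (cases "\<theta> Z")
      case (real c)
      have "(1 - t) * a + t * c \<le> b"
        using \<open>ereal (1 - t) * ereal a + ereal t * \<theta> Z \<le> ereal b\<close> real by simp
      then have "t * (c - a) \<le> - (a - b)" by (simp add: algebra_simps)
      then have "c - a \<le> - (a - b) / t" using t by (simp add: pos_le_divide_eq mult.commute)
      also have "- (a - b) / t = - (1 / \<mu> * (r - s1))"
        using False s ab by (simp add: t_def \<mu>_def field_simps)
      finally have "c \<le> a + s1 / \<mu> - 1 / \<mu> * r" by (simp add: diff_divide_distrib)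
      also have "\<dots> \<le> \<beta> - 1 / \<mu> * r"
        using ab s pos divide_right_mono[of s1 s2 \<mu>] by (simp add: \<beta>_def)
      finally show ?thesis using real by simp
    qed (use \<theta>0[of Z] in auto)
  qed
  then have "Z \<in> decay_set E \<mu> \<beta>"
    unfolding decay_set_def extremal_eq_SUP by (auto intro: SUP_least)
  then show thesis using that pos by blast
qed

lemma ennreal_suminf_ge_one_eq_top:
  fixes f :: "nat \<Rightarrow> ennreal"
  assumes "\<And>j. 1 \<le> f j"
  shows "(\<Sum>j. f j) = \<infinity>"
proof -
  have "\<infinity> = (\<integral>\<^sup>+ j. 1 \<partial>count_space (UNIV :: nat set))" by simp
  also have "\<dots> = (\<Sum>j :: nat. 1)" by (rule nn_integral_count_space_nat)
  also have "\<dots> \<le> (\<Sum>j. f j)" by (intro suminf_le assms) auto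
  finally show ?thesis by (simp add: top_unique)
qed

text \<open>
  The weights \<open>w j\<close> sum to 1, but \<open>w j * s j = 1\<close>: on \<open>E\<close> the series diverges, while at \<open>Z\<close> it
  is an average of values above \<open>c\<close>.
\<close>

lemma not_in_hull_if_extremal_bounded_below:
  assumes "\<And>s. 0 < s \<Longrightarrow> ereal c < extremal Z s E"
  shows "Z \<notin> pluripolar_hull E"
proof -
  define s where "s j = (2 :: real) ^ Suc j" for j :: nat
  define w where "w j = (1 / 2 :: real) ^ Suc j" for j :: nat
  have s: "0 < s j" for j by (simp add: s_def)
  have "\<exists>\<phi>\<in>competitors (s j) E. ereal c < \<phi> Z" for j
    using assms[OF s[of j]] unfolding extremal_eq_SUP less_SUP_iff .
  then obtain \<phi> where \<phi>: "\<And>j. \<phi> j \<in> competitors (s j) E" "\<And>j. ereal c < \<phi> j Z" by metis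
  have w0: "0 \<le> w j" for j by (simp add: w_def)
  have "w sums 1" unfolding w_def by (rule power_half_series)
  then have w: "(\<Sum>j. ennreal (w j)) = 1"
    using suminf_ennreal_eq[OF w0] by simp
  have le0: "\<phi> j W \<le> 0" for j W
    by (rule competitors_le_zero[OF \<phi>(1) less_imp_le[OF s]])
  have "mixture w \<phi> \<in> PSH_omega"
    using \<phi>(1) le0 w by (intro mixture_in_PSH_omega) (auto simp: competitors_iff)
  moreover have "mixture w \<phi> W = - \<infinity>" if "W \<in> E" for W
  proof -
    have "1 \<le> ennreal (w j) * e2ennreal (- \<phi> j W)" for j
    proof -
      have "\<phi> j W \<le> ereal (- s j)" using \<phi>(1) \<open>W \<in> E\<close> unfolding competitors_iff by blast
      then have "ereal (s j) \<le> - \<phi> j W" by (cases "\<phi> j W") auto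
      then have "ennreal (s j) \<le> e2ennreal (- \<phi> j W)" using e2ennreal_mono by (metis e2ennreal_ereal)
      then have "ennreal (w j) * ennreal (s j) \<le> ennreal (w j) * e2ennreal (- \<phi> j W)"
        by (rule mult_left_mono) simp
      moreover have "w j * s j = 1" by (simp add: w_def s_def power_divide)
      then have "ennreal (w j) * ennreal (s j) = 1" using s[of j] by (simp add: ennreal_mult''[symmetric])
      ultimately show ?thesis by simp
    qed
    then show ?thesis unfolding mixture_def by (subst ennreal_suminf_ge_one_eq_top) auto
  qed
  moreover have "mixture w \<phi> Z \<noteq> - \<infinity>"
  proof -
    have "(\<Sum>j. ennreal (w j) * e2ennreal (- \<phi> j Z)) \<le> (\<Sum>j. ennreal (w j) * ennreal (- c))"
    proof (intro suminf_le mult_left_mono)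
      fix j
      have "- \<phi> j Z \<le> ereal (- c)" using \<phi>(2)[of j] by (cases "\<phi> j Z") auto
      then show "e2ennreal (- \<phi> j Z) \<le> ennreal (- c)" using e2ennreal_mono by (metis e2ennreal_ereal)
    qed auto
    also have "\<dots> = ennreal (- c)" by (simp add: ennreal_suminf_multc w)
    finally have "(\<Sum>j. ennreal (w j) * e2ennreal (- \<phi> j Z)) < top"
      using ennreal_less_top le_less_trans by blast
    then show ?thesis unfolding mixture_def
      by (cases "\<Sum>j. ennreal (w j) * e2ennreal (- \<phi> j Z)") (auto simp: enn2ereal_ennreal)
  qed
  ultimately show ?thesis unfolding pluripolar_hull_def by blast
qed

text \<open>
  A function that is \<open>- \<infinity>\<close> on \<open>E\<close>, once made nonpositive by subtracting a constant, competes for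
  every \<open>s\<close> at once, so its value at \<open>Z\<close> lies below every \<open>\<beta> - s / \<mu>\<close>.
\<close>

lemma decay_set_subset_hull:
  assumes "0 < \<mu>"
  shows "decay_set E \<mu> \<beta> \<subseteq> pluripolar_hull E"
proof
  fix Z assume Z: "Z \<in> decay_set E \<mu> \<beta>"
  have "\<phi> Z = - \<infinity>" if \<phi>: "\<phi> \<in> PSH_omega" "\<forall>W\<in>E. \<phi> W = - \<infinity>" for \<phi>
  proof -
    obtain C where C: "\<And>W. \<phi> W \<le> ereal C" using PSH_omega_bounded_above[OF \<phi>(1)] by blast
    let ?\<theta> = "\<lambda>W. \<phi> W - ereal C"
    have "?\<theta> W \<le> 0" for W using C[of W] by (cases "\<phi> W") (auto simp: zero_ereal_def)
    then have "?\<theta> \<in> competitors s E" for s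
      using \<phi> PSH_omega_diff_const unfolding competitors_iff by auto
    then have "?\<theta> Z \<le> ereal (\<beta> - 1 / \<mu> * s)" if "0 < s" for s
      using Z that SUP_upper[of ?\<theta> "competitors s E" "\<lambda>\<phi>. \<phi> Z"] order_trans
      unfolding decay_set_def extremal_eq_SUP by blast
    note le = this
    show ?thesis
    proof (cases "\<phi> Z")
      case (real a)
      define s where "s = \<mu> * (\<bar>\<beta> - (a - C)\<bar> + 1)"
      have "0 < s" using assms by (simp add: s_def)
      then have "a - C \<le> \<beta> - 1 / \<mu> * s" using le real by simp
      moreover have "1 / \<mu> * s = \<bar>\<beta> - (a - C)\<bar> + 1" using assms by (simp add: s_def)
      ultimately show ?thesis by linarith
    qed (use C[of Z] in auto)
  qed
  then show "Z \<in> pluripolar_hull E" unfolding pluripolar_hull_def by blast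
qed

theorem theorem2p21:
  fixes E :: "('n::finite) cproj set"
  assumes "pluripolar E"
  shows "pluripolar_hull E = (\<Union>\<mu>\<in>{0<..}. decay_set_infinity E \<mu>)"
proof
  show "(\<Union>\<mu>\<in>{0<..}. decay_set_infinity E \<mu>) \<subseteq> pluripolar_hull E"
    using decay_set_subset_hull unfolding decay_set_infinity_def by fastforce
next
  show "pluripolar_hull E \<subseteq> (\<Union>\<mu>\<in>{0<..}. decay_set_infinity E \<mu>)"
  proof
    fix Z assume Z: "Z \<in> pluripolar_hull E"
    have "\<exists>\<mu> \<beta>. 0 < \<mu> \<and> 0 < \<beta> \<and> Z \<in> decay_set E \<mu> \<beta>"
    proof (cases "\<exists>s1 s2. 0 \<le> s1 \<and> s1 < s2 \<and> extremal Z s2 E < extremal Z s1 E")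
      case True
      then show ?thesis using extremal_linear_decay by metis
    next
      case False
      then have ge: "extremal Z 0 E \<le> extremal Z s E" if "0 < s" for s using that by fastforce
      \<comment> \<open>The extremal function is constant in \<open>s\<close>; on the hull the constant must be \<open>- \<infinity>\<close>.\<close>
      have "extremal Z 0 E = - \<infinity>"
      proof (rule ccontr)
        assume "extremal Z 0 E \<noteq> - \<infinity>"
        then have "- \<infinity> < extremal Z 0 E" by simp
        then obtain c where "ereal c < extremal Z 0 E" using ereal_dense2 by blast
        then have "ereal c < extremal Z s E" if "0 < s" for s using ge[OF that] by (rule less_le_trans)
        then show False using not_in_hull_if_extremal_bounded_below Z by blast
      qed
      moreover have "extremal Z s E \<le> extremal Z 0 E" if "0 < s" for s
        unfolding extremal_eq_SUP using that by (intro SUP_subset_mono competitors_antimono) auto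
      ultimately have "Z \<in> decay_set E 1 1" unfolding decay_set_def by auto
      then show ?thesis by (meson zero_less_one)
    qed
    then show "Z \<in> (\<Union>\<mu>\<in>{0<..}. decay_set_infinity E \<mu>)"
      unfolding decay_set_infinity_def by blast
  qed
qed

end
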